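(* The following identity holds: \[ \sum_{n=0}^\infty \frac{3n-1}{2^n}\sum_{k=0}^n\binom{-1/3}{k}\binom{-2/3}{n-k}\binom{-1/6}{k}\binom{-5/6}{n-k}=\frac{3\sqrt6}{2\pi}. \]
   Context: For a complex number $x$ and an integer $k\ge 0$, the generalized binomial coefficient is $\binom{x}{k}=\frac{x(x-1)\cdots(x-k+1)}{k!}$ (with $\binom{x}{0}=1$). *)

theory Defs
  imports Complex_Main
begin

end

(*
  Write H(a,b;x) for the Gauss series 2F1(a,b;1;x).  The inner sum is the n-th coefficient of
  H(1/3,1/6;x) H(2/3,5/6;x), so the series is (3 theta - 1) applied to this product at x = 1/2,
  with theta = x d/dx.  The quadratic substitution x = 4z(1-z) turns the two factors into F(z) and
  F(z)/(1-2z), where F = H(1/3,2/3;.) is the function of Ramanujan's cubic theory, and x = 1/2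
  becomes z = (2 - sqrt 2)/4.  Ramanujan's modular equation of degree 2 in the cubic theory reads
  F(alpha) = (1+p) F(beta) with alpha = p(3+p)^2/(2(1+p)^3) and beta = p^2(3+p)/4; at
  p = sqrt 2 - 1 one has beta = z and alpha = 1 - z, so it and its derivative express F and F' at
  1 - z by their values at z.  Substituting this into the Legendre relation (constancy of the
  Wronskian of F(z) and F(1-z)) gives the closed form.

  All transformations are instances of one fact: a second order equation (P y')' = Q y with P
  vanishing at 0 has, up to scaling, only one solution with P y' -> 0 at 0.
*)
theory Submission
  imports Defs "HOL-Analysis.Gamma_Function"
begin

section \<open>The Gauss series 2F1(a,b;1;x): coefficients, derivatives, continuity\<close>

definition hypergeo_coeff :: "real \<Rightarrow> real \<Rightarrow> nat \<Rightarrow> real" where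
  "hypergeo_coeff a b n = pochhammer a n * pochhammer b n / (fact n)\<^sup>2"

definition hypergeo :: "real \<Rightarrow> real \<Rightarrow> real \<Rightarrow> real" where
  "hypergeo a b x = (\<Sum>n. hypergeo_coeff a b n * x ^ n)"

text \<open>The Euler operator x d/dx applied to the Gauss series, defined termwise: it makes sense
  at 0, where it vanishes, and it enters Cauchy products directly.\<close>

definition hypergeo_theta :: "real \<Rightarrow> real \<Rightarrow> real \<Rightarrow> real" where
  "hypergeo_theta a b x = (\<Sum>n. real n * hypergeo_coeff a b n * x ^ n)"

lemma hypergeo_coeff_0 [simp]: "hypergeo_coeff a b 0 = 1"
  by (simp add: hypergeo_coeff_def)

lemma hypergeo_coeff_Suc:
  "(real n + 1)\<^sup>2 * hypergeo_coeff a b (Suc n) = (a + n) * (b + n) * hypergeo_coeff a b n"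
proof -
  have "hypergeo_coeff a b (Suc n) =
      (pochhammer a n * (a + n)) * (pochhammer b n * (b + n)) / ((real n + 1) * fact n)\<^sup>2"
    by (simp add: hypergeo_coeff_def pochhammer_Suc add.commute)
  moreover have "real n + 1 \<noteq> 0" by linarith
  ultimately show ?thesis
    unfolding hypergeo_coeff_def by (simp add: power_mult_distrib mult_ac)
qed

text \<open>As \<open>a\<close> and \<open>b\<close> are at most 1, each factor of the rising
  factorials is at most the matching factor of n!. The upper bound gives convergence for |x| < 1,
  the lower one positive solutions to divide by.\<close>

lemma hypergeo_coeff_bounds:
  assumes "0 < a" "a \<le> 1" "0 < b" "b \<le> 1"
  shows "0 < hypergeo_coeff a b n" "hypergeo_coeff a b n \<le> 1"
proof -
  show "0 < hypergeo_coeff a b n"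
    using assms by (simp add: hypergeo_coeff_def pochhammer_pos)
  have "pochhammer a n \<le> fact n" "pochhammer b n \<le> fact n"
    using assms unfolding pochhammer_fact pochhammer_prod by (auto intro!: prod_mono)
  then have "pochhammer a n * pochhammer b n \<le> fact n * fact n"
    using assms by (intro mult_mono) (auto intro: less_imp_le pochhammer_pos)
  then show "hypergeo_coeff a b n \<le> 1"
    by (simp add: hypergeo_coeff_def power2_eq_square)
qed

text \<open>The majorant (n + 1) |x|^n is the termwise derivative of the geometric series.\<close>

lemma summable_linear_growth:
  fixes c :: "nat \<Rightarrow> real"
  assumes "\<And>n. \<bar>c n\<bar> \<le> real n + 1" and "\<bar>x\<bar> < 1"
  shows "summable (\<lambda>n. \<bar>c n * x ^ n\<bar>)"
proof (rule summable_comparison_test')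
  have "summable (\<lambda>n. diffs (\<lambda>_. 1) n * \<bar>x\<bar> ^ n)"
    using assms(2) by (intro termdiff_converges[of _ 1]) (auto simp: summable_geometric)
  then show "summable (\<lambda>n. (real n + 1) * \<bar>x\<bar> ^ n)"
    by (simp add: diffs_def add.commute)
  show "norm \<bar>c n * x ^ n\<bar> \<le> (real n + 1) * \<bar>x\<bar> ^ n" for n
    using assms(1)[of n] by (simp add: abs_mult power_abs mult_right_mono)
qed

context
  fixes a b :: real
  assumes ab: "0 < a" "a \<le> 1" "0 < b" "b \<le> 1"
begin

lemma hypergeo_summable: 
  assumes "\<bar>x\<bar> < 1"
  shows "summable (\<lambda>n. \<bar>hypergeo_coeff a b n * x ^ n\<bar>)"
    and "summable (\<lambda>n. \<bar>real n * hypergeo_coeff a b n * x ^ n\<bar>)"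
proof -
  note B = hypergeo_coeff_bounds[OF ab]
  show "summable (\<lambda>n. \<bar>hypergeo_coeff a b n * x ^ n\<bar>)"
    using B by (intro summable_linear_growth assms) (smt (verit) of_nat_0_le_iff)
  have "\<bar>real n * hypergeo_coeff a b n\<bar> \<le> real n + 1" for n
    using B[of n] mult_left_le[of "hypergeo_coeff a b n" "real n"] by (simp add: abs_mult)
  then show "summable (\<lambda>n. \<bar>real n * hypergeo_coeff a b n * x ^ n\<bar>)"
    by (intro summable_linear_growth assms)
qed

lemma hypergeo_sums:
  assumes "\<bar>x\<bar> < 1"
  shows "(\<lambda>n. hypergeo_coeff a b n * x ^ n) sums hypergeo a b x"
    and "(\<lambda>n. real n * hypergeo_coeff a b n * x ^ n) sums hypergeo_theta a b x"
  unfolding hypergeo_def hypergeo_theta_def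
  using hypergeo_summable[OF assms] by (auto intro!: summable_sums dest: summable_rabs_cancel)

lemma hypergeo_0 [simp]: "hypergeo a b 0 = 1"
  and hypergeo_theta_0 [simp]: "hypergeo_theta a b 0 = 0"
  unfolding hypergeo_def hypergeo_theta_def by (simp_all add: powser_zero)

lemma hypergeo_pos:
  assumes "0 \<le> x" "x < 1"
  shows "0 < hypergeo a b x"
proof -
  have "(\<Sum>n<1. hypergeo_coeff a b n * x ^ n) \<le> hypergeo a b x"
    using hypergeo_sums(1)[of x] assms hypergeo_coeff_bounds(1)[OF ab]
    unfolding hypergeo_def by (intro sum_le_suminf) (auto simp: sums_iff less_imp_le)
  then show ?thesis by simp
qed

lemma hypergeo_deriv:
  assumes "\<bar>x\<bar> < 1" "x \<noteq> 0"
  shows "(hypergeo a b has_real_derivative hypergeo_theta a b x / x) (at x)"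
proof -
  let ?u = "hypergeo_coeff a b"
  have sm: "summable (\<lambda>n. ?u n * z ^ n)" if "norm z < 1" for z
    using hypergeo_sums(1)[of z] that by (auto simp: sums_iff)
  have D: "(hypergeo a b has_real_derivative (\<Sum>n. diffs ?u n * x ^ n)) (at x)"
    unfolding hypergeo_def[abs_def] using assms by (intro termdiffs_strong'[of 1] sm) auto
  have "(\<lambda>n. real n * ?u n * x ^ (n - Suc 0)) sums (\<Sum>n. diffs ?u n * x ^ n)"
    using termdiff_converges[of x 1 ?u] sm assms by (intro diffs_equiv) auto
  then have "(\<lambda>n. x * (real n * ?u n * x ^ (n - Suc 0))) sums (x * (\<Sum>n. diffs ?u n * x ^ n))"
    by (rule sums_mult)
  also have "(\<lambda>n. x * (real n * ?u n * x ^ (n - Suc 0))) = (\<lambda>n. real n * ?u n * x ^ n)"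
  proof
    show "x * (real n * ?u n * x ^ (n - Suc 0)) = real n * ?u n * x ^ n" for n
      by (cases n) auto
  qed
  finally have "hypergeo_theta a b x = x * (\<Sum>n. diffs ?u n * x ^ n)"
    using hypergeo_sums(2)[of x] assms by (simp add: sums_unique2)
  then show ?thesis using D assms by simp
qed

text \<open>The hypergeometric equation, solved for the derivative of theta H; on coefficients it is
  the recurrence \<open>hypergeo_coeff_Suc\<close>. In this form it covers x = 0 as well.\<close>

lemma hypergeo_theta_deriv:
  assumes "\<bar>x\<bar> < 1"
  shows "(hypergeo_theta a b has_real_derivative
           (a * b * hypergeo a b x + (a + b) * hypergeo_theta a b x) / (1 - x)) (at x)"
proof -
  let ?u = "hypergeo_coeff a b" and ?v = "\<lambda>n. real n * hypergeo_coeff a b n"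
  let ?S = "\<Sum>n. diffs ?v n * x ^ n"
  have sm: "summable (\<lambda>n. ?v n * z ^ n)" if "norm z < 1" for z
    using hypergeo_sums(2)[of z] that by (auto simp: sums_iff)
  have D: "(hypergeo_theta a b has_real_derivative ?S) (at x)"
    unfolding hypergeo_theta_def[abs_def] using assms by (intro termdiffs_strong'[of 1] sm) auto
  have S: "(\<lambda>n. diffs ?v n * x ^ n) sums ?S"
    using termdiff_converges[of x 1 ?v] sm assms by (intro summable_sums) auto
  have "(\<lambda>n. real n * ?v n * x ^ (n - Suc 0)) sums ?S"
    using S by (intro diffs_equiv) (simp add: sums_iff)
  then have "(\<lambda>n. x * (real n * ?v n * x ^ (n - Suc 0))) sums (x * ?S)"
    by (rule sums_mult)
  then have "(\<lambda>n. x * (real n * ?v n * x ^ (n - Suc 0)) + ((a + b) * (?v n * x ^ n)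
      + a * b * (?u n * x ^ n))) sums
      (x * ?S + ((a + b) * hypergeo_theta a b x + a * b * hypergeo a b x))"
    by (rule sums_add) (intro sums_add sums_mult hypergeo_sums assms)
  also have "(\<lambda>n. x * (real n * ?v n * x ^ (n - Suc 0)) + ((a + b) * (?v n * x ^ n)
      + a * b * (?u n * x ^ n))) = (\<lambda>n. diffs ?v n * x ^ n)"
  proof
    fix n
    have "x * (real n * ?v n * x ^ (n - Suc 0)) = real n * ?v n * x ^ n"
      by (cases n) auto
    moreover have "diffs ?v n = (a + n) * (b + n) * ?u n"
      using hypergeo_coeff_Suc[of n a b] by (simp add: diffs_def power2_eq_square algebra_simps)
    ultimately show "x * (real n * ?v n * x ^ (n - Suc 0)) + ((a + b) * (?v n * x ^ n)
      + a * b * (?u n * x ^ n)) = diffs ?v n * x ^ n"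
      by (simp add: algebra_simps)
  qed
  finally have "?S = x * ?S + ((a + b) * hypergeo_theta a b x + a * b * hypergeo a b x)"
    using S by (simp add: sums_unique2)
  then have "?S = (a * b * hypergeo a b x + (a + b) * hypergeo_theta a b x) / (1 - x)"
    using assms by (simp add: field_simps)
  with D show ?thesis by simp
qed

lemma continuous_on_hypergeo:
  assumes "continuous_on S g" "\<And>x. x \<in> S \<Longrightarrow> \<bar>g x\<bar> < 1"
  shows "continuous_on S (\<lambda>x. hypergeo a b (g x))"
proof -
  have "isCont (hypergeo a b) x" if "\<bar>x\<bar> < 1" for x
    unfolding hypergeo_def[abs_def] 
    using that hypergeo_sums(1)
    by (intro DERIV_isCont[OF termdiffs_strong'[of 1]]) (auto simp: sums_iff)
  then have "continuous_on {-1<..<1} (hypergeo a b)"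
    by (auto intro!: continuous_at_imp_continuous_on)
  then show ?thesis
    by (rule continuous_on_compose2[OF _ assms(1)]) (use assms(2) in force)
qed

lemma continuous_on_hypergeo_theta:
  assumes "continuous_on S g" "\<And>x. x \<in> S \<Longrightarrow> \<bar>g x\<bar> < 1"
  shows "continuous_on S (\<lambda>x. hypergeo_theta a b (g x))"
proof -
  have "continuous_on {-1<..<1} (hypergeo_theta a b)"
    by (auto intro!: continuous_at_imp_continuous_on DERIV_isCont[OF hypergeo_theta_deriv])
  then show ?thesis
    by (rule continuous_on_compose2[OF _ assms(1)]) (use assms(2) in force)
qed

lemma hypergeo_deriv_chain:
  assumes "(g has_real_derivative g') (at x)" "\<bar>g x\<bar> < 1" "g x \<noteq> 0"
  shows "((\<lambda>x. hypergeo a b (g x)) has_real_derivative hypergeo_theta a b (g x) / g x * g') (at x)"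
  using DERIV_chain2[OF hypergeo_deriv assms(1)] assms by simp

lemma hypergeo_theta_deriv_chain:
  assumes "(g has_real_derivative g') (at x)" "\<bar>g x\<bar> < 1"
  shows "((\<lambda>x. hypergeo_theta a b (g x)) has_real_derivative
    (a * b * hypergeo a b (g x) + (a + b) * hypergeo_theta a b (g x)) / (1 - g x) * g') (at x)"
  using DERIV_chain2[OF hypergeo_theta_deriv assms(1)] assms by simp

end

section \<open>Uniqueness of solutions with vanishing flux at 0\<close>

text \<open>
  The equation \<open>(P y')' = Q y\<close> is written as a first order system with \<open>E = P y'\<close>, so that nothing
  needs to be assumed about \<open>P\<close>; the proof shows that \<open>E1 y2 - E2 y1\<close>, and then \<open>y2 / y1\<close>, is constant.
\<close>

lemma fuchs_unique:
  fixes y1 y2 E1 E2 P Q :: "real \<Rightarrow> real"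
  assumes "0 < c"
    and cont: "continuous_on {0..c} y1" "continuous_on {0..c} y2"
              "continuous_on {0..c} E1" "continuous_on {0..c} E2"
    and init: "y1 0 = y2 0" "E1 0 = 0" "E2 0 = 0"
    and pos: "\<And>x. \<lbrakk>0 \<le> x; x \<le> c\<rbrakk> \<Longrightarrow> 0 < y1 x"
    and dy: "\<And>x. \<lbrakk>0 < x; x < c\<rbrakk> \<Longrightarrow> (y1 has_real_derivative E1 x / P x) (at x)"
            "\<And>x. \<lbrakk>0 < x; x < c\<rbrakk> \<Longrightarrow> (y2 has_real_derivative E2 x / P x) (at x)"
    and dE: "\<And>x. \<lbrakk>0 < x; x < c\<rbrakk> \<Longrightarrow> (E1 has_real_derivative Q x * y1 x) (at x)"
            "\<And>x. \<lbrakk>0 < x; x < c\<rbrakk> \<Longrightarrow> (E2 has_real_derivative Q x * y2 x) (at x)"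
  shows "y2 c = y1 c" "E2 c = E1 c"
proof -
  have W: "E1 x * y2 x = E2 x * y1 x" if "0 \<le> x" "x \<le> c" for x
  proof -
    have "E1 x * y2 x - E2 x * y1 x = E1 0 * y2 0 - E2 0 * y1 0"
    proof (rule DERIV_isconst2[OF \<open>0 < c\<close>])
      show "continuous_on {0..c} (\<lambda>x. E1 x * y2 x - E2 x * y1 x)"
        by (intro continuous_intros cont)
      show "((\<lambda>x. E1 x * y2 x - E2 x * y1 x) has_real_derivative 0) (at t)"
        if "0 < t" "t < c" for t
        by (rule derivative_eq_intros dy dE that refl)+ (simp add: algebra_simps)
    qed (use that in auto)
    then show ?thesis using init by simp
  qed
  have "y2 c / y1 c = y2 0 / y1 0"
  proof (rule DERIV_isconst2[OF \<open>0 < c\<close>])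
    show "continuous_on {0..c} (\<lambda>x. y2 x / y1 x)"
      using pos by (intro continuous_intros cont) (force dest: less_imp_neq)
    show "((\<lambda>x. y2 x / y1 x) has_real_derivative 0) (at t)" if "0 < t" "t < c" for t
    proof -
      have "0 < y1 t" using pos that by simp
      then show ?thesis
        using W[of t] that by (auto intro!: derivative_eq_intros dy simp: field_simps)
    qed
  qed (use \<open>0 < c\<close> in auto)
  then show y: "y2 c = y1 c" using init pos[of 0] pos[of c] \<open>0 < c\<close> by (simp add: field_simps)
  show "E2 c = E1 c" using W[of c] y pos[of c] \<open>0 < c\<close> by simp
qed

section \<open>An Abelian limit theorem\<close>

text \<open>The weights (1 - x) x^n have sum 1, so the expression is a weighted mean of the
  \<open>c n\<close>. As x -> 1 each single weight tends to 0, and the tail, where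
  \<open>c n\<close> is close to \<open>L\<close>, decides.\<close>

lemma Abel_mean_limit:
  fixes c :: "nat \<Rightarrow> real"
  assumes c: "c \<longlonglongrightarrow> L"
  shows "((\<lambda>x. (1 - x) * (\<Sum>n. c n * x ^ n)) \<longlongrightarrow> L) (at_left 1)"
proof (rule tendstoI)
  fix e :: real assume e: "0 < e"
  obtain N where N: "\<And>n. n \<ge> N \<Longrightarrow> \<bar>c n - L\<bar> < e / 2"
    using LIMSEQ_D[OF c, of "e/2"] e by auto
  \<comment> \<open>\<open>S\<close> collects the early terms; its factor 1 - x makes them vanish in
    the limit.\<close>
  define S where "S = (\<Sum>n<N. \<bar>c n - L\<bar>)"
  obtain C where C: "\<And>n. \<bar>c n - L\<bar> \<le> C"
    using convergent_imp_Bseq[OF convergentI[OF tendsto_diff[OF c tendsto_const[of L]]]]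
    unfolding Bseq_def by auto
  have bound: "\<bar>(1 - x) * (\<Sum>n. c n * x ^ n) - L\<bar> \<le> (1 - x) * S + e / 2" 
    if x: "0 < x" "x < 1" for x
  proof -
    let ?d = "\<lambda>n. \<bar>c n - L\<bar> * x ^ n"
    have gs: "(\<lambda>n. x ^ n) sums (1 / (1 - x))" using x by (intro geometric_sums) auto
    have sd: "summable ?d"
    proof (rule summable_comparison_test')
      show "summable (\<lambda>n. C * x ^ n)" using gs by (intro summable_mult) (auto simp: sums_iff)
      show "norm (?d n) \<le> C * x ^ n" for n using C[of n] x by (simp add: mult_right_mono)
    qed
    have sd': "summable (\<lambda>n. (c n - L) * x ^ n)"
      by (rule summable_rabs_cancel) (use sd x in \<open>simp add: abs_mult\<close>)
    have "(\<lambda>n. (c n - L) * x ^ n + L * x ^ n) sums ((\<Sum>n. (c n - L) * x ^ n) + L * (1 / (1 - x)))"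
      by (intro sums_add sums_mult gs summable_sums sd')
    then have "(\<Sum>n. c n * x ^ n) = (\<Sum>n. (c n - L) * x ^ n) + L * (1 / (1 - x))"
      by (simp add: sums_iff algebra_simps)
    then have "(1 - x) * (\<Sum>n. c n * x ^ n) - L = (1 - x) * (\<Sum>n. (c n - L) * x ^ n)"
      using x by (simp add: field_simps)
    then have scaled: "\<bar>(1 - x) * (\<Sum>n. c n * x ^ n) - L\<bar> = (1 - x) * \<bar>\<Sum>n. (c n - L) * x ^ n\<bar>"
      using x by (simp add: abs_mult)
    have "\<bar>\<Sum>n. (c n - L) * x ^ n\<bar> \<le> (\<Sum>n. ?d n)"
      using summable_rabs[of "\<lambda>n. (c n - L) * x ^ n"] sd x by (simp add: abs_mult)
    also have "(\<Sum>n. ?d n) \<le> (\<Sum>n. (if n < N then \<bar>c n - L\<bar> else 0) + e / 2 * x ^ n)"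
    proof (rule suminf_le[OF _ sd])
      show "?d n \<le> (if n < N then \<bar>c n - L\<bar> else 0) + e / 2 * x ^ n" for n
      proof (cases "n < N")
        case True
        have "?d n \<le> \<bar>c n - L\<bar> * 1" using x by (intro mult_left_mono power_le_one) auto
        moreover have "0 \<le> e / 2 * x ^ n" using x e by simp
        ultimately show ?thesis using True by simp
      next
        case False
        then show ?thesis using N[of n] x by (simp add: mult_right_mono)
      qed
      show "summable (\<lambda>n. (if n < N then \<bar>c n - L\<bar> else 0) + e / 2 * x ^ n)"
        using gs summable_finite[of "{..<N}" "\<lambda>n. if n < N then \<bar>c n - L\<bar> else 0"]
        by (intro summable_add summable_mult) (simp_all add: sums_iff)
    qed
    also have "\<dots> = S + e / 2 * (1 / (1 - x))"
    proof -
      have "(\<lambda>n. if n \<in> {..<N} then \<bar>c n - L\<bar> else 0) sums S"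
        unfolding S_def by (rule sums_If_finite_set) simp
      then have "(\<lambda>n. (if n \<in> {..<N} then \<bar>c n - L\<bar> else 0) + e / 2 * x ^ n) 
          sums (S + e / 2 * (1 / (1 - x)))"
        by (intro sums_add sums_mult gs)
      then show ?thesis by (simp add: sums_iff)
    qed
    finally have "\<bar>\<Sum>n. (c n - L) * x ^ n\<bar> \<le> S + e / 2 * (1 / (1 - x))" .
    then have "(1 - x) * \<bar>\<Sum>n. (c n - L) * x ^ n\<bar> \<le> (1 - x) * (S + e / 2 * (1 / (1 - x)))"
      using x by (intro mult_left_mono) auto
    also have "\<dots> = (1 - x) * S + e / 2"
      using x by (simp add: field_split_simps)
    finally show ?thesis using scaled by simp
  qed
  have "((\<lambda>x. (1 - x) * S + e / 2) \<longlongrightarrow> (1 - 1) * S + e / 2) (at_left (1::real))"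
    by (intro tendsto_intros)
  then have "\<forall>\<^sub>F x in at_left 1. (1 - x) * S + e / 2 < e"
    using e by (intro order_tendstoD(2)[of _ "e/2"]) auto
  moreover have "\<forall>\<^sub>F x :: real in at_left 1. 0 < x \<and> x < 1"
    by (rule eventually_at_leftI[of 0]) auto
  ultimately show "\<forall>\<^sub>F x in at_left 1. dist ((1 - x) * (\<Sum>n. c n * x ^ n)) L < e"
    by eventually_elim (use bound in \<open>force simp: dist_real_def\<close>)
qed


section \<open>The cubic function F and its characterization\<close>

abbreviation "cubic \<equiv> hypergeo (1/3) (2/3)"
abbreviation "cubic_theta \<equiv> hypergeo_theta (1/3) (2/3)"

lemma cubic_deriv_chain:
  assumes "(g has_real_derivative g') (at x)" "\<bar>g x\<bar> < 1" "g x \<noteq> 0"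
  shows "((\<lambda>x. cubic (g x)) has_real_derivative cubic_theta (g x) / g x * g') (at x)"
  using assms by (intro hypergeo_deriv_chain) auto

text \<open>Since 1/3 + 2/3 = 1, the equation is self-adjoint: the flux z (1 - z) F'(z) = (1 - z)
  theta F(z) has derivative 2/9 F(z), where 2/9 = (1/3)(2/3).\<close>

lemma cubic_flux_deriv_chain:
  assumes "(g has_real_derivative g') (at x)" "\<bar>g x\<bar> < 1"
  shows "((\<lambda>x. (1 - g x) * cubic_theta (g x)) has_real_derivative 2/9 * cubic (g x) * g') (at x)"
proof -
  have T: "((\<lambda>x. cubic_theta (g x)) has_real_derivative
      (2/9 * cubic (g x) + cubic_theta (g x)) / (1 - g x) * g') (at x)"
    using hypergeo_theta_deriv_chain[of "1/3" "2/3", OF _ _ _ _ assms] by simp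
  have "1 - g x \<noteq> 0" using assms(2) by auto
  then have "(1 - g x) * ((2/9 * cubic (g x) + cubic_theta (g x)) / (1 - g x) * g')
      = (2/9 * cubic (g x) + cubic_theta (g x)) * g'"
    by simp
  then show ?thesis
    by (intro DERIV_cong[OF DERIV_mult[OF DERIV_diff[OF DERIV_const assms(1)] T]])
       (simp add: algebra_simps)
qed

text \<open>The case P = t (1 - t), Q = 2/9 of \<open>fuchs_unique\<close>, with \<open>E\<close> as
  the flux. A transformation formula then follows from two derivatives, continuity and the values at
  0.\<close>

lemma cubic_unique:
  assumes "0 < z" "z < 1"
    and cont: "continuous_on {0..z} y" "continuous_on {0..z} E"
    and init: "y 0 = 1" "E 0 = 0"
    and dy: "\<And>t. \<lbrakk>0 < t; t < z\<rbrakk> \<Longrightarrow> (y has_real_derivative E t / (t * (1 - t))) (at t)"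
    and dE: "\<And>t. \<lbrakk>0 < t; t < z\<rbrakk> \<Longrightarrow> (E has_real_derivative 2/9 * y t) (at t)"
  shows "y z = cubic z" "E z = (1 - z) * cubic_theta z"
proof -
  have 1: "continuous_on {0..z} cubic" "continuous_on {0..z} (\<lambda>t. (1 - t) * cubic_theta t)"
    using assms(2)
    by (auto intro!: continuous_intros continuous_on_hypergeo continuous_on_hypergeo_theta)
  have 2: "0 < cubic t" if "0 \<le> t" "t \<le> z" for t
    using that assms(2) by (intro hypergeo_pos) auto
  have 3: "(cubic has_real_derivative (1 - t) * cubic_theta t / (t * (1 - t))) (at t)"
    if "0 < t" "t < z" for t
    using cubic_deriv_chain[OF DERIV_ident, of t] that assms(2) by simp
  have 4: "((\<lambda>t. (1 - t) * cubic_theta t) has_real_derivative 2/9 * cubic t) (at t)"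
    if "0 < t" "t < z" for t
    using cubic_flux_deriv_chain[OF DERIV_ident, of t] that assms(2) by simp
  show "y z = cubic z" "E z = (1 - z) * cubic_theta z"
    using fuchs_unique[OF assms(1) 1(1) cont(1) 1(2) cont(2) _ _ _ 2 3 dy 4 dE] init by simp_all
qed

section \<open>Quadratic transformations x = 4z(1 - z)\<close>

lemma quadratic_transform_aux:
  fixes z :: real
  assumes "0 \<le> z" "z < 1/2"
  shows "\<bar>4 * z * (1 - z)\<bar> < 1" and "1 - 4 * z * (1 - z) = (1 - 2 * z)\<^sup>2"
proof -
  show eq: "1 - 4 * z * (1 - z) = (1 - 2 * z)\<^sup>2"
    by (simp add: power2_eq_square algebra_simps)
  have "0 < (1 - 2 * z)\<^sup>2" using assms by simp
  moreover have "0 \<le> z * (1 - z)" using assms by simp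
  ultimately show "\<bar>4 * z * (1 - z)\<bar> < 1" using eq by linarith
qed

text \<open>With x = 4t(1 - t) one has x'/x = (1 - 2t)/(t(1 - t)), so the flux of the left side is
  (1 - 2t) theta H(x), and \<open>cubic_unique\<close> applies. The second claim equates the fluxes,
  because derivatives also enter the final sum.\<close>

lemma quadratic_transform_A:
  assumes "0 < z" "z < 1/2"
  shows "hypergeo (1/3) (1/6) (4 * z * (1 - z)) = cubic z"
    and "(1 - 2 * z) * hypergeo_theta (1/3) (1/6) (4 * z * (1 - z)) = (1 - z) * cubic_theta z"
proof -
  let ?A = "\<lambda>z. hypergeo (1/3) (1/6) (4 * z * (1 - z))"
  let ?T = "\<lambda>z. hypergeo_theta (1/3) (1/6) (4 * z * (1 - z))"
  have dx: "((\<lambda>z. 4 * z * (1 - z)) has_real_derivative 4 * (1 - 2 * t)) (at t)" for t :: real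
    by (auto intro!: derivative_eq_intros)
  have dy: "(?A has_real_derivative (1 - 2 * t) * ?T t / (t * (1 - t))) (at t)"
    if t: "0 < t" "t < z" for t
  proof -
    have "(?A has_real_derivative ?T t / (4 * t * (1 - t)) * (4 * (1 - 2 * t))) (at t)"
      using t assms quadratic_transform_aux(1)[of t] by (intro hypergeo_deriv_chain dx) auto
    then show ?thesis using t assms by (rule_tac DERIV_cong) (auto simp: field_simps)
  qed
  have dE: "((\<lambda>t. (1 - 2 * t) * ?T t) has_real_derivative 2/9 * ?A t) (at t)"
    if t: "0 < t" "t < z" for t
  proof -
    have "(?T has_real_derivative
        (1/3 * (1/6) * ?A t + (1/3 + 1/6) * ?T t) / (1 - 4 * t * (1 - t)) * (4 * (1 - 2 * t))) (at t)"
      using t assms quadratic_transform_aux(1)[of t] by (intro hypergeo_theta_deriv_chain dx) auto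
    \<comment> \<open>Here 4/18 = 2/9 and 4/2 = 2, and 1 - x = (1 - 2t)^2 leaves one factor 1 - 2t
      below. The term 2 theta H will offset the derivative of the factor 1 - 2t in the flux.\<close>
    then have "(?T has_real_derivative (2/9 * ?A t + 2 * ?T t) / (1 - 2 * t)) (at t)"
      using t assms quadratic_transform_aux(2)[of t]
      by (rule_tac DERIV_cong) (auto simp: divide_simps power2_eq_square, simp add: algebra_simps)
    note dT = this
    have "((\<lambda>t. (1 - 2 * t) * ?T t) has_real_derivative
        (- 2) * ?T t + (1 - 2 * t) * ((2/9 * ?A t + 2 * ?T t) / (1 - 2 * t))) (at t)"
      by (rule derivative_eq_intros dT refl)+ (simp add: algebra_simps)
    moreover have "(1 - 2 * t) * ((2/9 * ?A t + 2 * ?T t) / (1 - 2 * t)) = 2/9 * ?A t + 2 * ?T t"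
      using t assms by simp
    ultimately show ?thesis by simp
  qed
  have cx: "continuous_on {0..z} (\<lambda>z. 4 * z * (1 - z))"
    by (intro continuous_intros)
  have "continuous_on {0..z} ?A" "continuous_on {0..z} ?T"
    using assms quadratic_transform_aux(1) cx
    by (auto intro!: continuous_on_hypergeo continuous_on_hypergeo_theta)
  then have "continuous_on {0..z} ?A" "continuous_on {0..z} (\<lambda>t. (1 - 2 * t) * ?T t)"
    by (auto intro!: continuous_intros)
  from cubic_unique[OF _ _ this _ _ dy dE]
  show "?A z = cubic z" "(1 - 2 * z) * ?T z = (1 - z) * cubic_theta z"
    using assms by simp_all
qed

text \<open>The factor 1 - 2z is the square root of 1 - x in Euler's transformation H(2/3,5/6;x) =
  (1 - x)^(-1/2) H(1/3,1/6;x). Rather than pass through it, the proof checks that (1 - 2z)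
  H(2/3,5/6;x) and its flux satisfy the system of \<open>cubic_unique\<close>.\<close>

lemma quadratic_transform_B:
  assumes "0 < z" "z < 1/2"
  shows "(1 - 2 * z) * hypergeo (2/3) (5/6) (4 * z * (1 - z)) = cubic z"
    and "(1 - 2 * z)\<^sup>2 * hypergeo_theta (2/3) (5/6) (4 * z * (1 - z))
           - 2 * z * (1 - z) * hypergeo (2/3) (5/6) (4 * z * (1 - z)) = (1 - z) * cubic_theta z"
proof -
  let ?B = "\<lambda>z. hypergeo (2/3) (5/6) (4 * z * (1 - z))"
  let ?T = "\<lambda>z. hypergeo_theta (2/3) (5/6) (4 * z * (1 - z))"
  let ?L = "\<lambda>z. (1 - 2 * z) * ?B z"
  let ?E = "\<lambda>z. (1 - 2 * z)\<^sup>2 * ?T z - 2 * z * (1 - z) * ?B z"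
  have dx: "((\<lambda>z. 4 * z * (1 - z)) has_real_derivative 4 * (1 - 2 * t)) (at t)" for t :: real
    by (auto intro!: derivative_eq_intros)
  have dB: "(?B has_real_derivative (1 - 2 * t) * ?T t / (t * (1 - t))) (at t)"
    if t: "0 < t" "t < z" for t
  proof -
    have "(?B has_real_derivative ?T t / (4 * t * (1 - t)) * (4 * (1 - 2 * t))) (at t)"
      using t assms quadratic_transform_aux(1)[of t] by (intro hypergeo_deriv_chain dx) auto
    then show ?thesis using t assms by (rule_tac DERIV_cong) (auto simp: field_simps)
  qed
  have dy: "(?L has_real_derivative ?E t / (t * (1 - t))) (at t)"
    if t: "0 < t" "t < z" for t
  proof -
    have "(?L has_real_derivative
        (- 2) * ?B t + (1 - 2 * t) * ((1 - 2 * t) * ?T t / (t * (1 - t)))) (at t)"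
      by (rule derivative_eq_intros dB t refl)+ (simp add: algebra_simps)
    then show ?thesis
      using t assms by (rule_tac DERIV_cong) (auto simp: divide_simps power2_eq_square)
  qed
  have dE: "(?E has_real_derivative 2/9 * ((1 - 2 * t) * ?B t)) (at t)"
    if t: "0 < t" "t < z" for t
  proof -
    have "(?T has_real_derivative
        (2/3 * (5/6) * ?B t + (2/3 + 5/6) * ?T t) / (1 - 4 * t * (1 - t)) * (4 * (1 - 2 * t))) (at t)"
      using t assms quadratic_transform_aux(1)[of t] by (intro hypergeo_theta_deriv_chain dx) auto
    then have dT: "(?T has_real_derivative (20/9 * ?B t + 6 * ?T t) / (1 - 2 * t)) (at t)"
      using t assms quadratic_transform_aux(2)[of t]
      by (rule_tac DERIV_cong) (auto simp: divide_simps power2_eq_square, simp add: algebra_simps)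
    have D: "(?E has_real_derivative (- 4 * (1 - 2 * t)) * ?T t
        + (1 - 2 * t)\<^sup>2 * ((20/9 * ?B t + 6 * ?T t) / (1 - 2 * t))
        - ((2 - 4 * t) * ?B t + 2 * t * (1 - t) * ((1 - 2 * t) * ?T t / (t * (1 - t))))) (at t)"
      by (rule derivative_eq_intros dT dB t refl)+ (simp add: algebra_simps)
    have eq1: "(1 - 2 * t)\<^sup>2 * ((20/9 * ?B t + 6 * ?T t) / (1 - 2 * t))
        = (1 - 2 * t) * (20/9 * ?B t + 6 * ?T t)"
      using t assms by (simp add: power2_eq_square)
    have eq2: "2 * t * (1 - t) * ((1 - 2 * t) * ?T t / (t * (1 - t))) = 2 * ((1 - 2 * t) * ?T t)"
      using t assms by (simp add: field_simps)
    \<comment> \<open>Up to the common factor 1 - 2t, the theta terms cancel, -4 + 6 - 2 = 0, and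
      the \<open>?B\<close> terms leave 20/9 - 2 = 2/9.\<close>
    show ?thesis
      by (rule DERIV_cong[OF D]) (simp only: eq1 eq2, simp add: field_simps)
  qed
  have cx: "continuous_on {0..z} (\<lambda>z. 4 * z * (1 - z))"
    by (intro continuous_intros)
  have "continuous_on {0..z} ?B" "continuous_on {0..z} ?T"
    using assms quadratic_transform_aux(1) cx
    by (auto intro!: continuous_on_hypergeo continuous_on_hypergeo_theta)
  then have "continuous_on {0..z} ?L" "continuous_on {0..z} ?E"
    by (auto intro!: continuous_intros)
  from cubic_unique[OF _ _ this _ _ dy dE]
  show "(1 - 2 * z) * ?B z = cubic z" "?E z = (1 - z) * cubic_theta z"
    using assms by simp_all
qed

section \<open>The modular equation of degree 2 in the cubic theory\<close>

text \<open>
  With \<open>P\<close> below and \<open>Q = (2/9) \<alpha>'\<close>, both \<open>cubic (\<alpha> p)\<close> and \<open>(1 + p) cubic (\<beta> p)\<close> satisfy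
  \<open>(P y')' = Q y\<close>; \<open>P\<close> is \<open>\<alpha> (1 - \<alpha>) / \<alpha>'\<close>.
\<close>

definition mod_alpha :: "real \<Rightarrow> real" where
  "mod_alpha p = p * (3 + p)\<^sup>2 / (2 * (1 + p) ^ 3)"

definition mod_beta :: "real \<Rightarrow> real" where
  "mod_beta p = p\<^sup>2 * (3 + p) / 4"

definition mod_P :: "real \<Rightarrow> real" where
  "mod_P p = p * (3 + p) * (1 - p) * (2 + p) / (6 * (1 + p)\<^sup>2)"

lemma mod_compl:
  assumes "0 \<le> p"
  shows "1 - mod_alpha p = (1 - p)\<^sup>2 * (2 + p) / (2 * (1 + p) ^ 3)"
    and "1 - mod_beta p = (1 - p) * (2 + p)\<^sup>2 / 4"
proof -
  have "1 + p \<noteq> 0" using assms by auto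
  then show "1 - mod_alpha p = (1 - p)\<^sup>2 * (2 + p) / (2 * (1 + p) ^ 3)"
    unfolding mod_alpha_def by (simp add: divide_simps) algebra
  show "1 - mod_beta p = (1 - p) * (2 + p)\<^sup>2 / 4"
    unfolding mod_beta_def by (simp add: divide_simps) algebra
qed

lemma mod_bounds:
  assumes "0 < p" "p < 1"
  shows "0 < mod_alpha p" "mod_alpha p < 1" "0 < mod_beta p" "mod_beta p < 1" "0 < mod_P p"
proof -
  show "0 < mod_alpha p" "0 < mod_beta p" "0 < mod_P p"
    using assms by (auto simp: mod_alpha_def mod_beta_def mod_P_def)
  have "0 < 1 - mod_alpha p" "0 < 1 - mod_beta p" using assms by (auto simp: mod_compl)
  then show "mod_alpha p < 1" "mod_beta p < 1" by auto
qed

text \<open>The last two relations say that P d/dp yields the flux of F at \<alpha> and, up to the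
  factor 2/(1 + p)^2, at \<beta>. The formula for P' is what (P y')' = Q y demands of y = (1 + p)
  F(\<beta>). Hiding the explicit derivatives keeps rational functions out of the next
  proof.\<close>

lemma mod_derivs:
  assumes "0 < p" "p < 1"
  obtains a' b' where "(mod_alpha has_real_derivative a') (at p)"
    and "(mod_beta has_real_derivative b') (at p)"
    and "(mod_P has_real_derivative 2/9 * a' * (1 + p) - 4/9 * b' / (1 + p)) (at p)"
    and "mod_P p * a' = mod_alpha p * (1 - mod_alpha p)"
    and "mod_P p * b' * (1 + p)\<^sup>2 = 2 * mod_beta p * (1 - mod_beta p)"
proof
  let ?a = "3 * (3 + p) * (1 - p) / (2 * (1 + p) ^ 4)" and ?b = "3 * p * (2 + p) / 4"
  have m: "1 + p \<noteq> 0" using assms by simp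
  show "(mod_alpha has_real_derivative ?a) (at p)"
    unfolding mod_alpha_def[abs_def]
    apply (rule derivative_eq_intros refl | simp add: m)+
    apply (simp add: m divide_simps)
    apply algebra
    done
  show "(mod_beta has_real_derivative ?b) (at p)"
    unfolding mod_beta_def[abs_def]
    by (auto intro!: derivative_eq_intros simp: field_simps power2_eq_square)
  show "(mod_P has_real_derivative 2/9 * ?a * (1 + p) - 4/9 * ?b / (1 + p)) (at p)"
    unfolding mod_P_def[abs_def]
    apply (rule derivative_eq_intros refl | simp add: m)+
    apply (simp add: m divide_simps)
    apply algebra
    done
  show "mod_P p * ?a = mod_alpha p * (1 - mod_alpha p)"
    using assms m by (simp add: mod_compl) (simp add: mod_P_def mod_alpha_def divide_simps, algebra)
  show "mod_P p * ?b * (1 + p)\<^sup>2 = 2 * mod_beta p * (1 - mod_beta p)"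
    using assms m by (simp add: mod_compl) (simp add: mod_P_def mod_beta_def divide_simps, algebra)
qed

text \<open>Both sides of the first claim are 1 at p = 0, and their fluxes, which are the two sides
  of the second claim, vanish there; \<open>fuchs_unique\<close> identifies them. The second claim
  is thus P times the derivative of the first.\<close>

lemma cubic_modular_equation:
  assumes "0 < p" "p < 1"
  shows "(1 + p) * cubic (mod_beta p) = cubic (mod_alpha p)"
    and "mod_P p * cubic (mod_beta p) + 2 * ((1 - mod_beta p) * cubic_theta (mod_beta p)) / (1 + p)
           = (1 - mod_alpha p) * cubic_theta (mod_alpha p)"
proof -
  let ?y = "\<lambda>p. (1 + p) * cubic (mod_beta p)"
  let ?D = "\<lambda>z. (1 - z) * cubic_theta z"
  let ?E = "\<lambda>p. mod_P p * cubic (mod_beta p) + 2 * ?D (mod_beta p) / (1 + p)"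
  let ?Q = "\<lambda>p. 2/9 * deriv mod_alpha p"
  have zero: "mod_alpha 0 = 0" "mod_beta 0 = 0" "mod_P 0 = 0"
    by (auto simp: mod_alpha_def mod_beta_def mod_P_def)
  have lt1: "\<bar>mod_alpha t\<bar> < 1" "\<bar>mod_beta t\<bar> < 1" "0 \<le> mod_alpha t" if "0 \<le> t" "t \<le> p" for t
    using that mod_bounds[of t] assms zero by (cases "t = 0"; force)+
  have cont: "continuous_on {0..p} mod_alpha" "continuous_on {0..p} mod_beta"
      "continuous_on {0..p} mod_P"
    unfolding mod_alpha_def[abs_def] mod_beta_def[abs_def] mod_P_def[abs_def]
    by (auto intro!: continuous_intros)
  have ders: "((\<lambda>t. cubic (mod_alpha t)) has_real_derivative ?D (mod_alpha t) / mod_P t) (at t)"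
      "(?y has_real_derivative ?E t / mod_P t) (at t)"
      "((\<lambda>t. ?D (mod_alpha t)) has_real_derivative ?Q t * cubic (mod_alpha t)) (at t)"
      "(?E has_real_derivative ?Q t * ?y t) (at t)"
    if t: "0 < t" "t < p" for t
  proof -
    have t1: "t < 1" using t assms by simp
    obtain a' b' where a: "(mod_alpha has_real_derivative a') (at t)"
      and b: "(mod_beta has_real_derivative b') (at t)"
      and P: "(mod_P has_real_derivative 2/9 * a' * (1 + t) - 4/9 * b' / (1 + t)) (at t)"
      and Pa: "mod_P t * a' = mod_alpha t * (1 - mod_alpha t)"
      and Pb: "mod_P t * b' * (1 + t)\<^sup>2 = 2 * mod_beta t * (1 - mod_beta t)"
      using mod_derivs[OF t(1) t1] by blast
    have [simp]: "deriv mod_alpha t = a'" using a by (rule DERIV_imp_deriv)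
    note bd = mod_bounds[OF t(1) t1]
    have ya: "((\<lambda>t. cubic (mod_alpha t)) has_real_derivative
        cubic_theta (mod_alpha t) / mod_alpha t * a') (at t)"
      using bd by (intro cubic_deriv_chain a) auto
    have yb: "((\<lambda>t. cubic (mod_beta t)) has_real_derivative
        cubic_theta (mod_beta t) / mod_beta t * b') (at t)"
      using bd by (intro cubic_deriv_chain b) auto
    have Db: "((\<lambda>t. ?D (mod_beta t)) has_real_derivative 2/9 * cubic (mod_beta t) * b') (at t)"
      using bd by (intro cubic_flux_deriv_chain b) auto
    have a'_eq: "a' = mod_alpha t * (1 - mod_alpha t) / mod_P t"
      using Pa bd by (simp add: field_simps)
    have b'_eq: "b' = 2 * mod_beta t * (1 - mod_beta t) / (mod_P t * (1 + t)\<^sup>2)"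
      using Pb bd t by (simp add: field_simps)
    have m: "1 + t \<noteq> 0" using t by simp
    show "((\<lambda>t. cubic (mod_alpha t)) has_real_derivative ?D (mod_alpha t) / mod_P t) (at t)"
      using ya bd by (simp add: a'_eq mult.commute)
    show "((\<lambda>t. ?D (mod_alpha t)) has_real_derivative ?Q t * cubic (mod_alpha t)) (at t)"
      using cubic_flux_deriv_chain[OF a] bd by (simp add: mult_ac)
    have yb': "((\<lambda>t. cubic (mod_beta t)) has_real_derivative
        2 * ?D (mod_beta t) / (mod_P t * (1 + t)\<^sup>2)) (at t)"
      using bd by (intro DERIV_cong[OF yb]) (simp add: b'_eq)
    show "(?y has_real_derivative ?E t / mod_P t) (at t)"
      apply (rule derivative_eq_intros yb' refl)+
      using bd m by (simp add: add_divide_distrib power2_eq_square)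
    show "(?E has_real_derivative ?Q t * ?y t) (at t)"
    proof (rule DERIV_cong[OF DERIV_add[OF DERIV_mult[OF P yb'] DERIV_divide[OF DERIV_cmult[OF Db]
          DERIV_add[OF DERIV_const DERIV_ident] m]]])
      \<comment> \<open>The term P F(\<beta>)' cancels the one that comes from differentiating 1/(1
        + t), so that only multiples of F(\<beta>) remain.\<close>
      have "2 * ?D (mod_beta t) / (mod_P t * (1 + t)\<^sup>2) * mod_P t
          = 2 * ?D (mod_beta t) / ((1 + t) * (1 + t))"
        using bd m by (simp add: power2_eq_square)
      then show "(2/9 * a' * (1 + t) - 4/9 * b' / (1 + t)) * cubic (mod_beta t)
          + 2 * ?D (mod_beta t) / (mod_P t * (1 + t)\<^sup>2) * mod_P t
          + (2 * (2/9 * cubic (mod_beta t) * b') * (1 + t) - 2 * ?D (mod_beta t) * (0 + 1))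
            / ((1 + t) * (1 + t)) = ?Q t * ?y t"
        using m by (simp add: diff_divide_distrib) (simp add: algebra_simps)
    qed
  qed
  have "continuous_on {0..p} (\<lambda>t. cubic (mod_alpha t))" "continuous_on {0..p} (\<lambda>t. cubic (mod_beta t))"
    using lt1 by (auto intro!: continuous_on_hypergeo cont)
  moreover have "continuous_on {0..p} (\<lambda>t. cubic_theta (mod_alpha t))"
      "continuous_on {0..p} (\<lambda>t. cubic_theta (mod_beta t))"
    using lt1 by (auto intro!: continuous_on_hypergeo_theta cont)
  ultimately have conts: "continuous_on {0..p} (\<lambda>t. cubic (mod_alpha t))" "continuous_on {0..p} ?y"
      "continuous_on {0..p} (\<lambda>t. ?D (mod_alpha t))" "continuous_on {0..p} ?E"
    by (auto intro!: continuous_intros cont)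
  have "0 < cubic (mod_alpha t)" if "0 \<le> t" "t \<le> p" for t
    using lt1[OF that] by (intro hypergeo_pos) auto
  then have "?y p = cubic (mod_alpha p) \<and> ?E p = ?D (mod_alpha p)"
    using fuchs_unique[OF assms(1) conts _ _ _ _ ders(1,2,3,4)] by (simp add: zero)
  then show "?y p = cubic (mod_alpha p)" "?E p = ?D (mod_alpha p)" by auto
qed

section \<open>The Legendre relation\<close>

text \<open>The coefficient is asymptotic to 1/(n Gamma(1/3) Gamma(2/3)), and by reflection
  Gamma(1/3) Gamma(2/3) = pi / sin(pi/3) = 2 pi / sqrt 3.\<close>

lemma cubic_coeff_limit: "(\<lambda>n. real n * hypergeo_coeff (1/3) (2/3) n) \<longlonglongrightarrow> sqrt 3 / (2 * pi)"
proof -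
  have "complex_of_real (rGamma (1/3) * rGamma (2/3)) = complex_of_real (sin (pi / 3) / pi)"
    using rGamma_reflection_complex[of "of_real (1/3)"]
    by (simp add: rGamma_complex_of_real[symmetric] sin_of_real[symmetric] del: rGamma_complex_of_real)
  then have G: "rGamma (1/3) * rGamma (2/3) = sqrt 3 / (2 * pi)"
    unfolding of_real_eq_iff by (simp add: sin_60)
  \<comment> \<open>\<open>rGamma_series\<close> at n has n + 1 factors in its rising factorial but
    only n! below, so the product matches the coefficient of index n + 1 after the correction n/(n +
    1).\<close>
  have "(\<lambda>n. rGamma_series (1/3) n * rGamma_series (2/3) n * (real n / real (Suc n)))
      \<longlonglongrightarrow> rGamma (1/3) * rGamma (2/3) * 1"
    by (intro tendsto_intros LIMSEQ_n_over_Suc_n)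
  moreover have "\<forall>\<^sub>F n in sequentially. 
      rGamma_series (1/3) n * rGamma_series (2/3) n * (real n / real (Suc n))
      = real (Suc n) * hypergeo_coeff (1/3) (2/3) (Suc n)"
    using eventually_gt_at_top[of 0]
  proof eventually_elim
    case (elim n)
    have "exp (1/3 * ln (real n)) * exp (2/3 * ln (real n)) = real n"
      using elim by (simp add: exp_add[symmetric] field_simps)
    then have "rGamma_series (1/3) n * rGamma_series (2/3) n =
        pochhammer (1/3) (Suc n) * pochhammer (2/3) (Suc n) / ((fact n)\<^sup>2 * real n)"
      unfolding rGamma_series_def by (simp add: power2_eq_square mult_ac)
    then show ?case
      using elim by (simp add: hypergeo_coeff_def power2_eq_square divide_simps mult_ac del: of_nat_Suc)
  qed
  ultimately have "(\<lambda>n. real (Suc n) * hypergeo_coeff (1/3) (2/3) (Suc n)) \<longlonglongrightarrow> sqrt 3 / (2 * pi)"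
    unfolding G by (simp add: tendsto_cong)
  then show ?thesis by (rule LIMSEQ_imp_Suc)
qed

text \<open>The left side is z (1 - z) times the Wronskian of F(z) and F(1 - z), constant by
  self-adjointness. Its value is the limit as z -> 0 from the right: the first summand is governed
  by \<open>cubic_coeff_limit\<close> through \<open>Abel_mean_limit\<close>, the second tends to
  0.\<close>

lemma cubic_legendre:
  assumes "0 < z" "z < 1"
  shows "cubic z * (z * cubic_theta (1 - z)) + (1 - z) * cubic_theta z * cubic (1 - z)
    = sqrt 3 / (2 * pi)"
proof -
  let ?K = "\<lambda>z. cubic z * (z * cubic_theta (1 - z)) + (1 - z) * cubic_theta z * cubic (1 - z)"
  let ?L = "sqrt 3 / (2 * pi)"
  have d: "(?K has_real_derivative 0) (at t)" if t: "0 < t" "t < 1" for t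
  proof -
    have r: "((\<lambda>t. 1 - t) has_real_derivative - 1) (at t)"
      by (auto intro!: derivative_eq_intros)
    have 1: "(cubic has_real_derivative cubic_theta t / t) (at t)"
      using cubic_deriv_chain[OF DERIV_ident, of t] t by simp
    have 2: "((\<lambda>t. cubic (1 - t)) has_real_derivative - cubic_theta (1 - t) / (1 - t)) (at t)"
      using cubic_deriv_chain[OF r] t by simp
    have 3: "((\<lambda>t. (1 - t) * cubic_theta t) has_real_derivative 2/9 * cubic t) (at t)"
      using cubic_flux_deriv_chain[OF DERIV_ident, of t] t by simp
    have 4: "((\<lambda>t. t * cubic_theta (1 - t)) has_real_derivative - 2/9 * cubic (1 - t)) (at t)"
      using cubic_flux_deriv_chain[OF r] t by simp
    show ?thesis
      by (rule derivative_eq_intros 1 2 3 4 refl)+ (use t in \<open>simp add: field_simps\<close>)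
  qed
  have const: "?K t = ?K z" if "0 < t" "t < 1" for t
    by (rule DERIV_isconst3[of 0 1]) (use assms that d in auto)
  have refl1: "filterlim (\<lambda>t::real. 1 - t) (at_left 1) (at_right 0)"
    by (auto simp: filterlim_at eventually_at_right_less
        intro!: tendsto_eq_intros eventually_at_rightI[of 0 1])
  have lim1: "((\<lambda>t. t * cubic_theta (1 - t)) \<longlongrightarrow> ?L) (at_right 0)"
    using filterlim_compose[OF Abel_mean_limit[OF cubic_coeff_limit] refl1]
    by (simp add: hypergeo_theta_def)
  \<comment> \<open>Coefficients tending to 0 already force t F(1 - t) -> 0; the logarithmic growth
    of F at 1 need not be made precise.\<close>
  have "(\<lambda>n. real n * hypergeo_coeff (1/3) (2/3) n * (1 / real n)) \<longlonglongrightarrow> ?L * 0"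
    by (intro tendsto_mult cubic_coeff_limit lim_1_over_n)
  moreover have "\<forall>\<^sub>F n in sequentially. real n * hypergeo_coeff (1/3) (2/3) n * (1 / real n)
      = hypergeo_coeff (1/3) (2/3) n"
    using eventually_gt_at_top[of 0] by eventually_elim simp
  ultimately have "hypergeo_coeff (1/3) (2/3) \<longlonglongrightarrow> 0"
    by (simp add: tendsto_cong)
  from filterlim_compose[OF Abel_mean_limit[OF this] refl1]
  have lim2: "((\<lambda>t. t * cubic (1 - t)) \<longlongrightarrow> 0) (at_right 0)"
    by (simp add: hypergeo_def)
  have "((\<lambda>h. (cubic_theta (0 + h) - cubic_theta 0) / h) \<longlongrightarrow> 2/9) (at 0)"
    using hypergeo_theta_deriv[of "1/3" "2/3" 0] by (simp add: DERIV_def)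
  then have lim3: "((\<lambda>t. cubic_theta t / t) \<longlongrightarrow> 2/9) (at_right 0)"
    by (auto intro: filterlim_mono simp: at_le)
  have "continuous_on {-1<..<1} cubic"
    by (rule continuous_on_hypergeo) (auto intro: continuous_intros)
  then have "isCont cubic 0" by (simp add: continuous_on_eq_continuous_at)
  then have lim4: "(cubic \<longlongrightarrow> 1) (at_right 0)"
    by (auto simp: isCont_def intro: filterlim_mono at_le)
  \<comment> \<open>The second summand of \<open>?K\<close> has the form 0 times infinity; moving a
    factor t across makes both parts converge.\<close>
  have "((\<lambda>t. cubic t * (t * cubic_theta (1 - t))
      + (1 - t) * (cubic_theta t / t) * (t * cubic (1 - t))) \<longlongrightarrow> 1 * ?L + (1 - 0) * (2/9) * 0) (at_right 0)"
    by (intro tendsto_intros lim1 lim2 lim3 lim4)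
  moreover have "\<forall>\<^sub>F t in at_right 0. cubic t * (t * cubic_theta (1 - t))
      + (1 - t) * (cubic_theta t / t) * (t * cubic (1 - t)) = ?K z"
  proof (rule eventually_at_rightI[of 0 1])
    show "cubic t * (t * cubic_theta (1 - t))
      + (1 - t) * (cubic_theta t / t) * (t * cubic (1 - t)) = ?K z" if "t \<in> {0<..<1}" for t
      using const[of t] that by simp
  qed simp
  ultimately have "((\<lambda>_. ?K z) \<longlongrightarrow> ?L) (at_right (0::real))"
    by (simp add: tendsto_cong)
  then show ?thesis by (simp add: tendsto_const_iff)
qed

section \<open>Evaluation of the series\<close>

text \<open>Each binomial is (-1)^k times a rising factorial over k!, and the two signs cancel.
  Pairing the four binomials of the theorem this way turns its inner sum into a Cauchy product
  coefficient.\<close>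

lemma gbinomial_mult_eq_hypergeo_coeff:
  "((- a) gchoose k) * ((- b) gchoose k) = hypergeo_coeff a b k"
proof -
  have "((- 1) ^ k * (- 1) ^ k :: real) = 1" by (simp add: power_mult_distrib[symmetric])
  then show ?thesis
    unfolding gbinomial_pochhammer hypergeo_coeff_def by (simp add: power2_eq_square field_simps)
qed

theorem theorem1:
  "(\<lambda>n::nat. (3 * real n - 1) / 2 ^ n *
      (\<Sum>k=0..n. ((-1/3 :: real) gchoose k) * ((-2/3 :: real) gchoose (n - k)) *
                 ((-1/6 :: real) gchoose k) * ((-5/6 :: real) gchoose (n - k))))
    sums (3 * sqrt 6 / (2 * pi))"
proof -
  let ?A = "hypergeo (1/3) (1/6) (1/2)" and ?TA = "hypergeo_theta (1/3) (1/6) (1/2)"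
  let ?B = "hypergeo (2/3) (5/6) (1/2)" and ?TB = "hypergeo_theta (2/3) (5/6) (1/2)"
  let ?u = "hypergeo_coeff (1/3) (1/6)" and ?v = "hypergeo_coeff (2/3) (5/6)"
  define s :: real where "s = sqrt 2"
  have s2: "s * s = 2" by (simp add: s_def)
  have s_bounds: "1 < s" "s < 2" unfolding s_def by (auto intro: real_less_lsqrt)
  \<comment> \<open>The root of 4z(1 - z) = 1/2 below 1/2, where the quadratic transformations
    hold.\<close>
  define z where "z = (2 - s) / 4"
  define f where "f = cubic z"
  define D where "D = (1 - z) * cubic_theta z"
  have z: "0 < z" "z < 1/2" using s_bounds by (auto simp: z_def)
  have x: "4 * z * (1 - z) = 1/2" and w: "1 - 2 * z = s / 2"
    using s2 by (auto simp: z_def field_simps)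
  have sq: "(s - 1)\<^sup>2 = 3 - 2 * s" "(2 + s)\<^sup>2 = 6 + 4 * s" "s\<^sup>2 = 2" "s ^ 3 = 2 * s"
    using s2 by (auto simp: power2_eq_square power3_eq_cube algebra_simps)
  have shift: "3 + (s - 1) = 2 + s" "1 + (s - 1) = s" "2 + (s - 1) = 1 + s" "1 - (s - 1) = 2 - s"
    by auto
  \<comment> \<open>The point p = s - 1 is fixed by p -> (1 - p)/(1 + p), a substitution that
    carries \<beta> to 1 - \<alpha>; hence \<alpha> and \<beta> are complementary here.\<close>
  have mb: "mod_beta (s - 1) = z"
    unfolding mod_beta_def z_def shift sq using s2 by (simp add: field_simps)
  have ma: "mod_alpha (s - 1) = 1 - z"
    unfolding mod_alpha_def z_def shift sq using s2 s_bounds by (simp add: field_simps)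
  have "(s - 1) * (2 + s) * (2 - s) * (1 + s) = (s * s - 1) * (4 - s * s)"
    by (simp add: algebra_simps)
  then have mP: "mod_P (s - 1) = 1/6"
    unfolding mod_P_def shift sq using s2 by (simp add: algebra_simps)
  have A: "?A = f" and TA: "s / 2 * ?TA = D"
    using quadratic_transform_A[OF z] unfolding x w f_def D_def by auto
  have B: "s / 2 * ?B = f"  
    using quadratic_transform_B(1)[OF z] unfolding x w f_def by auto
  have "2 * z * (1 - z) = 1/4" using x by linarith
  then have TB: "(s / 2)\<^sup>2 * ?TB - 1/4 * ?B = D"
    using quadratic_transform_B(2)[OF z] unfolding x w D_def by (simp only:)
  have p: "0 < s - 1" "s - 1 < 1" using s_bounds by auto
  have f': "cubic (1 - z) = s * f"
    using cubic_modular_equation(1)[OF p] unfolding ma mb f_def by simp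
  have D': "z * cubic_theta (1 - z) = f / 6 + 2 * D / s"
    using cubic_modular_equation(2)[OF p] unfolding ma mb mP f_def D_def by simp
  \<comment> \<open>With the values at 1 - z eliminated, the Legendre relation becomes a quadratic
    relation between \<open>f\<close> and \<open>D\<close>.\<close>
  have leg: "f * (f / 6 + 2 * D / s) + D * (s * f) = sqrt 3 / (2 * pi)"
    using cubic_legendre[of z] z unfolding f' D' f_def[symmetric] D_def[symmetric] by simp
  have B': "?B = s * f" and TA': "?TA = s * D" and TB': "?TB = 2 * D + s * f / 2"
  proof -
    have "?B = s * (s / 2 * ?B)" using s2 by simp
    then show B': "?B = s * f" by (simp only: B)
    have "?TA = s * (s / 2 * ?TA)" using s2 by simp
    then show "?TA = s * D" by (simp only: TA)
    have half: "(s / 2)\<^sup>2 = 1/2" using s2 by (simp add: power2_eq_square)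
    from TB[unfolded half B'] show "?TB = 2 * D + s * f / 2" by simp
  qed
  have Ds: "2 * D / s = s * D" using s2 s_bounds by (simp add: field_simps)
  have total: "3 * (?TA * ?B + ?A * ?TB) - ?A * ?B = 3 * sqrt 6 / (2 * pi)"
  proof -
    \<comment> \<open>The value is 12 f D + s f^2 / 2, which is 3 s times the left side of
      \<open>leg\<close>; the weight 3n - 1 produces exactly this ratio. Writing 2 as
      \<open>s * s\<close> exposes the factor.\<close>
    have "3 * (?TA * ?B + ?A * ?TB) - ?A * ?B = (s * s) * 3 * f * D + 2 * (3 * f * D) + s / 2 * f * f"
      unfolding A B' TA' TB' by (simp add: algebra_simps)
    also have "\<dots> = (s * s) * 3 * f * D + (s * s) * (3 * f * D) + s / 2 * f * f"
      by (simp only: s2)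
    also have "\<dots> = 3 * s * (f * (f / 6 + s * D) + D * (s * f))"
      by (simp add: algebra_simps)
    also have "\<dots> = 3 * (s * sqrt 3) / (2 * pi)"
      using leg unfolding Ds by simp
    also have "s * sqrt 3 = sqrt 6" unfolding s_def by (simp add: real_sqrt_mult[symmetric])
    finally show ?thesis .
  qed
  let ?a = "\<lambda>n. ?u n * (1/2) ^ n" and ?a' = "\<lambda>n. real n * ?u n * (1/2) ^ n"
  let ?b = "\<lambda>n. ?v n * (1/2) ^ n" and ?b' = "\<lambda>n. real n * ?v n * (1/2) ^ n"
  have sm: "summable (\<lambda>n. norm (?a n))" "summable (\<lambda>n. norm (?a' n))"
      "summable (\<lambda>n. norm (?b n))" "summable (\<lambda>n. norm (?b' n))"
    unfolding real_norm_def by (intro hypergeo_summable; simp)+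
  \<comment> \<open>The product rule for theta corresponds to n = k + (n - k), so these three Cauchy
    products combine into the weight 3n - 1.\<close>
  have "(\<lambda>n. 3 * ((\<Sum>k\<le>n. ?a' k * ?b (n - k)) + (\<Sum>k\<le>n. ?a k * ?b' (n - k)))
        - (\<Sum>k\<le>n. ?a k * ?b (n - k))) sums (3 * (?TA * ?B + ?A * ?TB) - ?A * ?B)"
    unfolding hypergeo_def hypergeo_theta_def
    by (intro sums_diff sums_mult sums_add Cauchy_product_sums sm)
  also have "(\<lambda>n. 3 * ((\<Sum>k\<le>n. ?a' k * ?b (n - k)) + (\<Sum>k\<le>n. ?a k * ?b' (n - k)))
        - (\<Sum>k\<le>n. ?a k * ?b (n - k))) = (\<lambda>n. (3 * real n - 1) / 2 ^ n *
      (\<Sum>k=0..n. ((-1/3) gchoose k) * ((-2/3) gchoose (n - k)) *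
                 ((-1/6) gchoose k) * ((-5/6) gchoose (n - k))))"
  proof
    fix n
    have "3 * ((\<Sum>k\<le>n. ?a' k * ?b (n - k)) + (\<Sum>k\<le>n. ?a k * ?b' (n - k)))
        - (\<Sum>k\<le>n. ?a k * ?b (n - k))
        = (\<Sum>k\<le>n. 3 * (?a' k * ?b (n - k) + ?a k * ?b' (n - k)) - ?a k * ?b (n - k))"
      by (simp add: sum.distrib sum_subtractf sum_distrib_left)
    also have "\<dots> = (\<Sum>k\<le>n. (3 * real n - 1) / 2 ^ n * (?u k * ?v (n - k)))"
    proof (rule sum.cong[OF refl])
      fix k assume "k \<in> {..n}"
      then have k: "k \<le> n" by simp
      have pw: "(1/2 :: real) ^ k * (1/2) ^ (n - k) = 1 / 2 ^ n"
        using k by (simp add: power_add[symmetric] power_one_over)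
      have "3 * (?a' k * ?b (n - k) + ?a k * ?b' (n - k)) - ?a k * ?b (n - k)
          = (3 * real k + 3 * real (n - k) - 1) * (?u k * ?v (n - k)) * ((1/2) ^ k * (1/2) ^ (n - k))"
        by (simp only: algebra_simps)
      also have "3 * real k + 3 * real (n - k) = 3 * real n" using k by (simp add: of_nat_diff)
      finally show "3 * (?a' k * ?b (n - k) + ?a k * ?b' (n - k)) - ?a k * ?b (n - k)
          = (3 * real n - 1) / 2 ^ n * (?u k * ?v (n - k))"
        unfolding pw by simp
    qed
    also have "\<dots> = (3 * real n - 1) / 2 ^ n *
      (\<Sum>k=0..n. ((-1/3) gchoose k) * ((-2/3) gchoose (n - k)) *
                 ((-1/6) gchoose k) * ((-5/6) gchoose (n - k)))"
      unfolding sum_distrib_left[symmetric] atLeast0AtMost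
      by (simp add: gbinomial_mult_eq_hypergeo_coeff[symmetric] mult_ac)
    finally show "3 * ((\<Sum>k\<le>n. ?a' k * ?b (n - k)) + (\<Sum>k\<le>n. ?a k * ?b' (n - k)))
        - (\<Sum>k\<le>n. ?a k * ?b (n - k)) = (3 * real n - 1) / 2 ^ n *
      (\<Sum>k=0..n. ((-1/3) gchoose k) * ((-2/3) gchoose (n - k)) *
                 ((-1/6) gchoose k) * ((-5/6) gchoose (n - k)))" .
  qed
  finally show ?thesis unfolding total .
qed

end
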